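(* If $X$ is a finite partial group (i.e. a partial group with $X_1$ finite), then $X$ has only finitely many im-partial subgroups.
   Context: Let $\mathbf{\Upsilon}$ be the category with objects $[n]=\{0,1,\dots,n\}$ for $n\ge 0$ and with all functions as morphisms. A symmetric set is a functor $X\colon \mathbf{\Upsilon}^{\mathrm{op}}\to \mathsf{Set}$; write $X_n$ for $X([n])$, and for $\alpha\colon[m]\to[n]$ write $x\mapsto x\cdot\alpha$ for the induced map $X_n\to X_m$. For $x\in X_n$ and $i,j\in[n]$, write $x_{ij}=x\cdot\alpha\in X_1$ where $\alpha\colon[1]\to[n]$, $\alpha(0)=i$, $\alpha(1)=j$. For $n\ge 1$, a spine of $[n]$ is a tree $T$ with vertex set $[n]$; it gives a map $\mathscr{E}_T$ from $X_n$ to $\prod_{\{i,j\}\in T}X_1$ (product over the edges of $T$) whose $\{i,j\}$-component, for $i<j$, is $x\mapsto x_{ij}$. (Its image lies in the limit of the induced diagram, i.e. the subset of families of edges with matching endpoints; injectivity is unaffected by the choice of codomain.) $X$ is spiny if $\mathscr{E}_T$ is injective for every $n\ge1$ and every spine $T$ of $[n]$. A partial group is a spiny symmetric set $X$ that is reduced, meaning $X_0$ has exactly one element. A symmetric subset of $X$ is a subfunctor $Y\subseteq X$; an im-partial subgroup of a partial group $X$ is a nonempty symmetric subset $Y\subseteq X$. *)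

theory Defs
  imports "HOL-Library.FuncSet"
begin

abbreviation obj :: "nat \<Rightarrow> nat set" where
  "obj n \<equiv> {0..n}"

text \<open>The morphisms from \<open>[m]\<close> to \<open>[n]\<close> are the extensional functions, so each function between
  these finite sets has exactly one representative. The sets \<open>X\<^sub>n\<close> are carriers in one type.\<close>

locale symmetric_set =
  fixes X :: "nat \<Rightarrow> 'a set"
    and act :: "nat \<Rightarrow> nat \<Rightarrow> (nat \<Rightarrow> nat) \<Rightarrow> 'a \<Rightarrow> 'a"
  assumes act_closed: "\<And>m n \<alpha> x. \<alpha> \<in> obj m \<rightarrow>\<^sub>E obj n \<Longrightarrow> x \<in> X n \<Longrightarrow> act m n \<alpha> x \<in> X m"
    and act_id: "\<And>n x. x \<in> X n \<Longrightarrow> act n n (\<lambda>i\<in>obj n. i) x = x"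
    and act_comp: "\<And>k m n \<beta> \<alpha> x. \<beta> \<in> obj k \<rightarrow>\<^sub>E obj m \<Longrightarrow> \<alpha> \<in> obj m \<rightarrow>\<^sub>E obj n \<Longrightarrow> x \<in> X n \<Longrightarrow>
      act k n (compose (obj k) \<alpha> \<beta>) x = act k m \<beta> (act m n \<alpha> x)"

text \<open>The 1-simplex \<open>x\<^sub>i\<^sub>j\<close> of an \<open>n\<close>-simplex \<open>x\<close>.\<close>

definition edge :: "(nat \<Rightarrow> nat \<Rightarrow> (nat \<Rightarrow> nat) \<Rightarrow> 'a \<Rightarrow> 'a) \<Rightarrow> nat \<Rightarrow> 'a \<Rightarrow> nat \<Rightarrow> nat \<Rightarrow> 'a" where
  "edge act n x i j = act 1 n (\<lambda>k\<in>obj 1. if k = 0 then i else j) x"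

text \<open>Simple undirected graphs, given by a vertex set and a set of two-element sets of vertices.\<close>

definition simple_graph :: "'v set \<Rightarrow> 'v set set \<Rightarrow> bool" where
  "simple_graph V E \<longleftrightarrow> (\<forall>e\<in>E. e \<subseteq> V \<and> card e = 2)"

definition graph_connected :: "'v set \<Rightarrow> 'v set set \<Rightarrow> bool" where
  "graph_connected V E \<longleftrightarrow> V \<noteq> {} \<and> (\<forall>u\<in>V. \<forall>v\<in>V. (u, v) \<in> {(a, b). {a, b} \<in> E}\<^sup>*)"

definition graph_cycle :: "'v set set \<Rightarrow> 'v list \<Rightarrow> bool" where
  "graph_cycle E vs \<longleftrightarrow> 3 \<le> length vs \<and> distinct vs \<and>
     successively (\<lambda>a b. {a, b} \<in> E) vs \<and> {last vs, hd vs} \<in> E"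

definition graph_tree :: "'v set \<Rightarrow> 'v set set \<Rightarrow> bool" where
  "graph_tree V E \<longleftrightarrow> simple_graph V E \<and> graph_connected V E \<and> \<not> (\<exists>vs. graph_cycle E vs)"

definition spine :: "nat \<Rightarrow> nat set set \<Rightarrow> bool" where
  "spine n T \<longleftrightarrow> 1 \<le> n \<and> graph_tree (obj n) T"

text \<open>For an edge \<open>e = {i, j}\<close> with \<open>i < j\<close>, the values \<open>Min e\<close> and \<open>Max e\<close> are \<open>i\<close> and \<open>j\<close>.\<close>

definition spine_map ::
  "(nat \<Rightarrow> nat \<Rightarrow> (nat \<Rightarrow> nat) \<Rightarrow> 'a \<Rightarrow> 'a) \<Rightarrow> nat \<Rightarrow> nat set set \<Rightarrow> 'a \<Rightarrow> nat set \<Rightarrow> 'a" where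
  "spine_map act n T x = (\<lambda>e\<in>T. edge act n x (Min e) (Max e))"

definition spiny :: "(nat \<Rightarrow> 'a set) \<Rightarrow> (nat \<Rightarrow> nat \<Rightarrow> (nat \<Rightarrow> nat) \<Rightarrow> 'a \<Rightarrow> 'a) \<Rightarrow> bool" where
  "spiny X act \<longleftrightarrow> (\<forall>n\<ge>1. \<forall>T. spine n T \<longrightarrow> inj_on (spine_map act n T) (X n))"

definition reduced :: "(nat \<Rightarrow> 'a set) \<Rightarrow> bool" where
  "reduced X \<longleftrightarrow> (\<exists>!x. x \<in> X 0)"

locale partial_group = symmetric_set X act
  for X :: "nat \<Rightarrow> 'a set" and act :: "nat \<Rightarrow> nat \<Rightarrow> (nat \<Rightarrow> nat) \<Rightarrow> 'a \<Rightarrow> 'a" +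
  assumes spiny: "spiny X act"
    and reduced: "reduced X"

text \<open>A subfunctor is determined by its sets \<open>Y\<^sub>n\<close>, its action being the restriction of that of \<open>X\<close>.\<close>

definition symmetric_subset ::
  "(nat \<Rightarrow> 'a set) \<Rightarrow> (nat \<Rightarrow> nat \<Rightarrow> (nat \<Rightarrow> nat) \<Rightarrow> 'a \<Rightarrow> 'a) \<Rightarrow> (nat \<Rightarrow> 'a set) \<Rightarrow> bool" where
  "symmetric_subset X act Y \<longleftrightarrow> (\<forall>n. Y n \<subseteq> X n) \<and>
     (\<forall>m n. \<forall>\<alpha> \<in> obj m \<rightarrow>\<^sub>E obj n. \<forall>y\<in>Y n. act m n \<alpha> y \<in> Y m)"

definition im_partial_subgroup ::
  "(nat \<Rightarrow> 'a set) \<Rightarrow> (nat \<Rightarrow> nat \<Rightarrow> (nat \<Rightarrow> nat) \<Rightarrow> 'a \<Rightarrow> 'a) \<Rightarrow> (nat \<Rightarrow> 'a set) \<Rightarrow> bool" where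
  "im_partial_subgroup X act Y \<longleftrightarrow> symmetric_subset X act Y \<and> (\<exists>n. Y n \<noteq> {})"

end

theory Submission
  imports Defs
begin

text \<open>
  Every simplex of large dimension is degenerate, so an im-partial subgroup is determined by its
  low-dimensional part, which is a family of subsets of finitely many finite sets.

  For \<open>n \<ge> 1\<close>, the star with centre \<open>0\<close> is a spine of \<open>[n]\<close>. By spininess, an \<open>n\<close>-simplex \<open>x\<close> is
  therefore determined by its edges \<open>x\<^sub>0\<^sub>k\<close>; in particular all \<open>X\<^sub>n\<close> are finite when \<open>X\<^sub>1\<close> is
  (and \<open>X\<^sub>0\<close> is a singleton).
  If \<open>n \<ge> 1\<close> is at least the number of elements of \<open>X\<^sub>1\<close>, then \<open>x\<^sub>0\<^sub>i = x\<^sub>0\<^sub>j\<close> for some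
  \<open>i < j \<le> n\<close> by the pigeonhole principle. The map \<open>[n] \<rightarrow> [n]\<close> that sends \<open>j\<close> to \<open>i\<close> and fixes
  all other vertices fixes \<open>0\<close> and so preserves the edges of \<open>x\<close> at \<open>0\<close>; hence it
  fixes \<open>x\<close> (\<open>act_merge_vertices\<close>). It factors through \<open>[n - 1]\<close>, which means that \<open>x\<close> is
  obtained from one of its own \<open>(n - 1)\<close>-dimensional faces (\<open>high_simplex_degenerate\<close>).
  A symmetric subset contains \<open>x\<close> if and only if it contains that face, so its members
  of dimension \<open>n\<close> can be read off from those of dimension \<open>n - 1\<close>.
\<close>

definition star :: "nat \<Rightarrow> nat set set" where
  "star n = (\<lambda>k. {0, k}) ` {1..n}"

lemma star_iff: "{a, b} \<in> star n \<longleftrightarrow> a = 0 \<and> b \<in> {1..n} \<or> b = 0 \<and> a \<in> {1..n}"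
  by (auto simp: star_def doubleton_eq_iff)

text \<open>Two consecutive edges \<open>a b\<close> and \<open>b c\<close> of a cycle in a star must meet at the centre, and then
  the closing edge of the cycle, which ends at \<open>a\<close>, would avoid the centre.\<close>

lemma star_acyclic: "\<not> graph_cycle (star n) vs"
proof
  assume cycle: "graph_cycle (star n) vs"
  then obtain a b c ws where vs: "vs = a # b # c # ws"
    unfolding graph_cycle_def by (metis Suc_le_length_iff numeral_3_eq_3)
  have "distinct vs" "{a, b} \<in> star n" "{b, c} \<in> star n" "{last vs, a} \<in> star n"
    using cycle unfolding graph_cycle_def vs by auto
  moreover have "last vs \<in> set (c # ws)"
    unfolding vs by (metis last_ConsR last_in_set list.distinct(1))
  ultimately show False
    unfolding vs star_iff by auto
qed

lemma star_connected: "graph_connected (obj n) (star n)"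
proof -
  let ?R = "{(a, b). {a, b} \<in> star n}"
  have "(u, 0) \<in> ?R\<^sup>* \<and> (0, u) \<in> ?R\<^sup>*" if "u \<in> obj n" for u
    using that by (cases "u = 0") (auto simp: star_iff intro!: r_into_rtrancl)
  then show ?thesis
    unfolding graph_connected_def using rtrancl_trans[of _ 0 ?R] by auto
qed

lemma spine_star:
  assumes "1 \<le> n"
  shows "spine n (star n)"
proof -
  have "simple_graph (obj n) (star n)"
    unfolding simple_graph_def star_def by auto
  then show ?thesis
    using assms star_acyclic star_connected unfolding spine_def graph_tree_def by blast
qed

context symmetric_set
begin

lemma edge_closed:
  assumes "x \<in> X n" "i \<le> n" "j \<le> n"
  shows "edge act n x i j \<in> X 1"
  unfolding edge_def using assms by (intro act_closed[where n = n]) auto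

lemma edge_act:
  assumes "\<beta> \<in> obj n \<rightarrow>\<^sub>E obj m" "x \<in> X m" "i \<le> n" "j \<le> n"
  shows "edge act n (act n m \<beta> x) i j = edge act m x (\<beta> i) (\<beta> j)"
proof -
  let ?\<alpha> = "\<lambda>k\<in>obj 1. if k = 0 then i else j"
  have "compose (obj 1) \<beta> ?\<alpha> = (\<lambda>k\<in>obj 1. if k = 0 then \<beta> i else \<beta> j)"
    unfolding compose_def by (intro restrict_ext) simp
  moreover have "?\<alpha> \<in> obj 1 \<rightarrow>\<^sub>E obj n"
    using assms by auto
  ultimately show ?thesis
    unfolding edge_def using act_comp[of ?\<alpha> 1 n \<beta> m x] assms by simp
qed

end

context partial_group
begin

lemma eq_by_star_edges:
  assumes "1 \<le> n" "x \<in> X n" "y \<in> X n"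
    and "\<And>k. k \<in> {1..n} \<Longrightarrow> edge act n x 0 k = edge act n y 0 k"
  shows "x = y"
proof -
  have "spine_map act n (star n) x = spine_map act n (star n) y"
    unfolding spine_map_def using assms(4) by (intro restrict_ext) (auto simp: star_def)
  moreover have "inj_on (spine_map act n (star n)) (X n)"
    using spiny spine_star assms(1) unfolding spiny_def by blast
  ultimately show ?thesis
    using assms(2,3) by (auto dest: inj_onD)
qed

lemma finite_simplices:
  assumes "finite (X 1)"
  shows "finite (X n)"
proof (cases "n = 0")
  case True
  then show ?thesis
    using reduced unfolding reduced_def by (metis finite.simps insertI1 finite_subset subsetI)
next
  case False
  let ?f = "\<lambda>x. \<lambda>k\<in>{1..n}. edge act n x 0 k"
  have "inj_on ?f (X n)"
  proof (rule inj_onI)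
    fix x y assume xy: "x \<in> X n" "y \<in> X n" "?f x = ?f y"
    then have "edge act n x 0 k = edge act n y 0 k" if "k \<in> {1..n}" for k
      using that by (metis restrict_apply')
    then show "x = y"
      using xy(1,2) False by (intro eq_by_star_edges[of n x y]) simp_all
  qed
  moreover have "?f ` X n \<subseteq> {1..n} \<rightarrow>\<^sub>E X 1"
    using edge_closed by auto
  moreover have "finite ({1..n} \<rightarrow>\<^sub>E X 1)"
    using assms by (intro finite_PiE) auto
  ultimately show ?thesis
    by (meson finite_imageD finite_subset)
qed

text \<open>The inequality \<open>i < j\<close> guarantees that the vertex sent elsewhere is not the centre \<open>0\<close> of the
  star, on whose edges the comparison of simplices rests.\<close>

lemma act_merge_vertices:
  assumes "x \<in> X n" "i < j" "j \<le> n" "edge act n x 0 i = edge act n x 0 j"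
  shows "act n n (\<lambda>k\<in>obj n. if k = j then i else k) x = x"
proof -
  let ?e = "\<lambda>k\<in>obj n. if k = j then i else k"
  have e: "?e \<in> obj n \<rightarrow>\<^sub>E obj n"
    using assms by auto
  have "edge act n (act n n ?e x) 0 k = edge act n x 0 k" if "k \<in> {1..n}" for k
    using edge_act[OF e assms(1), of 0 k] assms that by auto
  moreover have "1 \<le> n"
    using assms(2,3) by simp
  ultimately show ?thesis
    using act_closed[OF e assms(1)] assms(1) eq_by_star_edges by blast
qed

lemma high_simplex_degenerate:
  assumes "finite (X 1)" "card (X 1) \<le> Suc m" "x \<in> X (Suc m)"
  obtains \<alpha> \<sigma> where "\<alpha> \<in> obj m \<rightarrow>\<^sub>E obj (Suc m)" "\<sigma> \<in> obj (Suc m) \<rightarrow>\<^sub>E obj m"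
    "act (Suc m) m \<sigma> (act m (Suc m) \<alpha> x) = x"
proof -
  let ?n = "Suc m"
  have "edge act ?n x 0 ` obj ?n \<subseteq> X 1"
    using edge_closed assms(3) by auto
  then have "card (edge act ?n x 0 ` obj ?n) < card (obj ?n)"
    using card_mono[OF assms(1), of "edge act ?n x 0 ` obj ?n"] assms(2) by simp
  then have "\<not> inj_on (edge act ?n x 0) (obj ?n)"
    by (rule pigeonhole)
  then obtain i j where ij: "i < j" "j \<le> ?n" "edge act ?n x 0 i = edge act ?n x 0 j"
    unfolding inj_on_def by (metis atLeastAtMost_iff linorder_neqE_nat)
  \<comment> \<open>Merging \<open>j\<close> into \<open>i\<close> factors as \<open>\<sigma>\<close>, which renumbers the vertices other than \<open>j\<close>,
    followed by the injection \<open>\<alpha>\<close> that misses \<open>j\<close>.\<close>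
  define \<alpha> where "\<alpha> = (\<lambda>k\<in>obj m. if k < j then k else Suc k)"
  define \<sigma> where "\<sigma> = (\<lambda>k\<in>obj ?n. if k = j then i else if k < j then k else k - 1)"
  have \<alpha>: "\<alpha> \<in> obj m \<rightarrow>\<^sub>E obj ?n" and \<sigma>: "\<sigma> \<in> obj ?n \<rightarrow>\<^sub>E obj m"
    using ij by (auto simp: \<alpha>_def \<sigma>_def)
  have "compose (obj ?n) \<alpha> \<sigma> = (\<lambda>k\<in>obj ?n. if k = j then i else k)"
    using ij by (auto simp: \<alpha>_def \<sigma>_def compose_def fun_eq_iff)
  then have "act ?n m \<sigma> (act m ?n \<alpha> x) = x"
    using act_comp[OF \<sigma> \<alpha> assms(3)] act_merge_vertices[OF assms(3) ij] by simp
  then show ?thesis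
    using that \<alpha> \<sigma> by blast
qed

text \<open>The step from \<open>m\<close> to \<open>Suc m\<close> goes down in \<open>Y\<close> along \<open>\<alpha>\<close>, across to \<open>Z\<close> by the induction
  hypothesis, and back up in \<open>Z\<close> along \<open>\<sigma>\<close>.\<close>

lemma symmetric_subset_le:
  assumes fin: "finite (X 1)"
    and Y: "symmetric_subset X act Y" and Z: "symmetric_subset X act Z"
    and low: "\<And>n. n \<le> card (X 1) \<Longrightarrow> Y n \<subseteq> Z n"
  shows "Y n \<subseteq> Z n"
proof (induction n)
  case 0
  then show ?case using low by blast
next
  case (Suc m)
  show ?case
  proof (cases "Suc m \<le> card (X 1)")
    case True
    then show ?thesis by (rule low)
  next
    case False
    then have high: "card (X 1) \<le> Suc m" by simp
    show ?thesis
    proof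
      fix x assume x: "x \<in> Y (Suc m)"
      then have "x \<in> X (Suc m)"
        using Y unfolding symmetric_subset_def by blast
      from high_simplex_degenerate[OF fin high this] obtain \<alpha> \<sigma> where \<alpha>: "\<alpha> \<in> obj m \<rightarrow>\<^sub>E obj (Suc m)"
        and \<sigma>: "\<sigma> \<in> obj (Suc m) \<rightarrow>\<^sub>E obj m"
        and eq: "act (Suc m) m \<sigma> (act m (Suc m) \<alpha> x) = x" .
      have "act m (Suc m) \<alpha> x \<in> Y m"
        using Y x \<alpha> unfolding symmetric_subset_def by blast
      with Suc.IH have "act m (Suc m) \<alpha> x \<in> Z m" by blast
      then have "act (Suc m) m \<sigma> (act m (Suc m) \<alpha> x) \<in> Z (Suc m)"
        using Z \<sigma> unfolding symmetric_subset_def by blast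
      then show "x \<in> Z (Suc m)" by (simp only: eq)
    qed
  qed
qed

lemma finite_symmetric_subsets:
  assumes fin: "finite (X 1)"
  shows "finite {Y. symmetric_subset X act Y}"
proof -
  let ?S = "{Y. symmetric_subset X act Y}" and ?low = "{..card (X 1)}"
  have "inj_on (\<lambda>Y. restrict Y ?low) ?S"
  proof (rule inj_onI)
    fix Y Z assume "Y \<in> ?S" "Z \<in> ?S" and eq: "restrict Y ?low = restrict Z ?low"
    then have Y: "symmetric_subset X act Y" and Z: "symmetric_subset X act Z"
      by simp_all
    have low: "Y n = Z n" if "n \<le> card (X 1)" for n
      using eq that by (metis atMost_iff restrict_apply')
    show "Y = Z"
    proof (rule ext, rule equalityI)
      fix n
      show "Y n \<subseteq> Z n"
        by (rule symmetric_subset_le[OF fin Y Z]) (simp add: low)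
      show "Z n \<subseteq> Y n"
        by (rule symmetric_subset_le[OF fin Z Y]) (simp add: low)
    qed
  qed
  moreover have "(\<lambda>Y. restrict Y ?low) ` ?S \<subseteq> (\<Pi>\<^sub>E n\<in>?low. Pow (X n))"
    unfolding symmetric_subset_def by fastforce
  moreover have "finite (\<Pi>\<^sub>E n\<in>?low. Pow (X n))"
    using finite_simplices[OF fin] by (intro finite_PiE) auto
  ultimately show ?thesis
    by (meson finite_imageD finite_subset)
qed

end

theorem corollary20:
  fixes X :: "nat \<Rightarrow> 'a set"
    and act :: "nat \<Rightarrow> nat \<Rightarrow> (nat \<Rightarrow> nat) \<Rightarrow> 'a \<Rightarrow> 'a"
  assumes "partial_group X act"
    and "finite (X 1)"
  shows "finite {Y. im_partial_subgroup X act Y}"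
proof (rule finite_subset)
  show "{Y. im_partial_subgroup X act Y} \<subseteq> {Y. symmetric_subset X act Y}"
    unfolding im_partial_subgroup_def by auto
  show "finite {Y. symmetric_subset X act Y}"
    using partial_group.finite_symmetric_subsets assms by blast
qed

end
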